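(* Let $j\in\{2,3,4\}$, $\lambda\in\{1,-1\}$, let $r>0$ be constant, and let $\beta$ be a unit-speed spacelike curve in $\mathbb{E}^4_1$ with non-null Frenet frame $\{F_1,F_2,F_3,F_4\}$ whose timelike member is $F_j$, and with first curvature $k_1$. Let $M$ be the tubular hypersurface $$\mathcal{T}^{\{j,\lambda\}}(s,t,w)=\beta(s)+r\sum_{i=2}^4\mu_i^{\lambda}F_i(s)$$ with Gauss map $N^{\{j,\lambda\}}=-(-1)^{(4-j)!}\lambda^j\sum_{i=2}^4\mu_i^\lambda F_i$. Then $M$ has $\mathcal{L}_2$-harmonic Gauss map, i.e. $\mathcal{L}_2N^{\{j,\lambda\}}=0$ on $M$, if and only if $k_1=0$ (identically).
   Context: $\mathbb{E}^4_1$ is $\mathbb{R}^4$ with the metric $\langle\ ,\ \rangle=-dx_1^2+dx_2^2+dx_3^2+dx_4^2$. The curve $\beta:I\to\mathbb{E}^4_1$ ($I$ an open interval) is smooth with $\beta'=F_1$, and $\{F_1,\dots,F_4\}$ is a smooth orthonormal frame along $\beta$ with $\langle F_j,F_j\rangle=-1$ and $\langle F_i,F_i\rangle=1$ for $i\neq j$, satisfying, with smooth curvature functions $k_1,k_2,k_3$ of $s$ (allowed to vanish), the Frenet equations - $j=2$: $F_1'=k_1F_2$, $F_2'=k_1F_1+k_2F_3$, $F_3'=k_2F_2+k_3F_4$, $F_4'=-k_3F_3$; - $j=3$: $F_1'=k_1F_2$, $F_2'=-k_1F_1+k_2F_3$, $F_3'=k_2F_2+k_3F_4$, $F_4'=k_3F_3$;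 - $j=4$: $F_1'=k_1F_2$, $F_2'=-k_1F_1+k_2F_3$, $F_3'=-k_2F_2+k_3F_4$, $F_4'=k_3F_3$. The functions $\mu_i^\lambda$ (depending on $j$) are given by $\mu_j^\lambda=(\sinh w)^{\frac{1+\lambda}2}(\cosh w)^{\frac{1-\lambda}2}\cosh t$, $\mu_{j+1}^\lambda=(\sinh w)^{\frac{1-\lambda}2}(\cosh w)^{\frac{1+\lambda}2}$, $\mu_{j+2}^\lambda=(\sinh w)^{\frac{1+\lambda}2}(\cosh w)^{\frac{1-\lambda}2}\sinh t$, with the index convention $\mu_5^\lambda=\mu_2^\lambda$, $\mu_6^\lambda=\mu_3^\lambda$. ($\lambda=1$: envelope of pseudo hyperspheres; $\lambda=-1$: envelope of pseudo hyperbolic hyperspheres, of radius $r$ centered on $\beta$.) The parameters $(s,t,w)$ range over a connected open set $U\subset I\times\mathbb{R}^2$ projecting onto $I$ on which $\mathcal{T}^{\{j,\lambda\}}$ is an immersion, i.e. $(\mu_{j+1}^\lambda)_w\neq0$ and $1+(-1)^{(4-j)!}rk_1\mu_2^\lambda\neq0$. The unit normal $N=N^{\{j,\lambda\}}$ has $\varepsilon=\langle N,N\rangle=\lambda$, and the principal curvatures with respect to $N$ (eigenvalues of $-dN$) are $\kappa_1=\kappa_2=\frac{(-1)^{(4-j)!}\lambda^j}{r}$, $\kappa_3=\frac{k_1\mu_2^\lambda}{\lambda^j(1+(-1)^{(4-j)!}rk_1\mu_2^\lambda)}$. Operator $\mathcal{L}_2$ on the Gauss map: put $a_1=-\sum_i\kappa_i$,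 $a_k=(-1)^k\sum_{i_1<\dots<i_k}\kappa_{i_1}\cdots\kappa_{i_k}$ ($k=2,3$), and define $H_k$ by $\binom{3}{k}H_k=(-\varepsilon)^ka_k$. Then $$\mathcal{L}_2N=-\varepsilon\,\mathfrak{C}_2\big(\nabla H_3+3H_1H_3\,N\big),\qquad \mathfrak{C}_2=\binom33(-\varepsilon)^2=1,$$ where $\nabla$ is the gradient on $M$ with respect to the induced metric, viewed as an $\mathbb{E}^4_1$-valued map. *)

theory Defs
  imports "HOL-Analysis.Analysis"
begin

section \<open>Parametrized hypersurfaces of Minkowski 4-space\<close>

definition mink :: "real^4 \<Rightarrow> real^4 \<Rightarrow> real" where
  "mink x y = - (x$1 * y$1) + x$2 * y$2 + x$3 * y$3 + x$4 * y$4"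

text \<open>On an open set of reals this is \<open>C\<^sup>\<infinity>\<close>: every iterated derivative is differentiable.\<close>

definition smooth_on :: "real set \<Rightarrow> (real \<Rightarrow> 'a::real_normed_vector) \<Rightarrow> bool" where
  "smooth_on I f \<longleftrightarrow>
     (\<forall>n. \<forall>s\<in>I. ((\<lambda>g x. vector_derivative g (at x)) ^^ n) f differentiable (at s))"

definition immersion_on :: "(real^3) set \<Rightarrow> (real^3 \<Rightarrow> real^4) \<Rightarrow> bool" where
  "immersion_on U X \<longleftrightarrow>
     (\<forall>p\<in>U. X differentiable (at p) \<and> inj (frechet_derivative X (at p)))"

text \<open>Below, \<open>X\<close> is an immersed hypersurface and \<open>N\<close> a unit normal field along it, both as
  functions of the parameters; tangent vectors are represented by their coordinates in
  \<open>\<real>\<^sup>3\<close>, that is, \<open>\<xi>\<close> stands for \<open>dX \<xi>\<close>.\<close>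

definition first_form :: "(real^3 \<Rightarrow> real^4) \<Rightarrow> real^3 \<Rightarrow> real^3^3" where
  "first_form X p = (\<chi> a b. mink (frechet_derivative X (at p) (axis a 1))
                               (frechet_derivative X (at p) (axis b 1)))"

text \<open>The gradient for the induced metric \<open>g\<close>, as a vector of the ambient space:
  \<open>\<Sum>a b. g\<^sup>a\<^sup>b (\<partial>\<^sub>b f) \<partial>\<^sub>a X\<close>.\<close>

definition surface_grad :: "(real^3 \<Rightarrow> real^4) \<Rightarrow> (real^3 \<Rightarrow> real) \<Rightarrow> real^3 \<Rightarrow> real^4" where
  "surface_grad X f p =
     frechet_derivative X (at p)
       (matrix_inv (first_form X p) *v (\<chi> b. frechet_derivative f (at p) (axis b 1)))"

text \<open>The shape operator \<open>-dN\<close>, as an endomorphism of the tangent space.\<close>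

definition shape_operator ::
    "(real^3 \<Rightarrow> real^4) \<Rightarrow> (real^3 \<Rightarrow> real^4) \<Rightarrow> real^3 \<Rightarrow> real^3 \<Rightarrow> real^3" where
  "shape_operator X N p \<xi> =
     (THE \<eta>. frechet_derivative X (at p) \<eta> = - frechet_derivative N (at p) \<xi>)"

text \<open>The principal curvatures are the eigenvalues of the shape operator, repeated according to
  their algebraic multiplicity (the shape operator need not be diagonalizable, the metric being
  indefinite). They are only determined up to order, which is immaterial for the symmetric
  functions formed from them.\<close>

definition principal_curvatures ::
    "(real^3 \<Rightarrow> real^4) \<Rightarrow> (real^3 \<Rightarrow> real^4) \<Rightarrow> real^3 \<Rightarrow> 3 \<Rightarrow> real" where
  "principal_curvatures X N p =
     (SOME \<kappa>. \<forall>x. det (mat x - matrix (shape_operator X N p)) = (\<Prod>i\<in>UNIV. x - \<kappa> i))"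

definition curv_coeff ::
    "(real^3 \<Rightarrow> real^4) \<Rightarrow> (real^3 \<Rightarrow> real^4) \<Rightarrow> nat \<Rightarrow> real^3 \<Rightarrow> real" where
  "curv_coeff X N k p =
     (- 1) ^ k * (\<Sum>A | A \<subseteq> UNIV \<and> card A = k. \<Prod>i\<in>A. principal_curvatures X N p i)"

definition mean_curv ::
    "(real^3 \<Rightarrow> real^4) \<Rightarrow> (real^3 \<Rightarrow> real^4) \<Rightarrow> nat \<Rightarrow> real^3 \<Rightarrow> real" where
  "mean_curv X N k p = (- mink (N p) (N p)) ^ k * curv_coeff X N k p / real (3 choose k)"

text \<open>\<open>\<L>\<^sub>2\<close> applied to the Gauss map, with \<open>\<epsilon> = \<langle>N, N\<rangle>\<close>.\<close>

definition L2_gauss ::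
    "(real^3 \<Rightarrow> real^4) \<Rightarrow> (real^3 \<Rightarrow> real^4) \<Rightarrow> real^3 \<Rightarrow> real^4" where
  "L2_gauss X N p =
     (let \<epsilon> = mink (N p) (N p); C2 = real (3 choose 3) * (- \<epsilon>) ^ 2 in
       (- \<epsilon> * C2) *\<^sub>R (surface_grad X (mean_curv X N 3) p
          + (3 * mean_curv X N 1 p * mean_curv X N 3 p) *\<^sub>R N p))"

section \<open>Curves with a non-null Frenet frame and their tubular hypersurfaces\<close>

text \<open>The frame is \<open>F 1, F 2, F 3, F 4\<close>; \<open>F j\<close> is its timelike member. The curve is unit-speed
  and spacelike since \<open>\<beta>' = F 1\<close> and \<open>j \<noteq> 1\<close>.\<close>

definition frenet_curve ::
    "nat \<Rightarrow> real set \<Rightarrow> (real \<Rightarrow> real^4) \<Rightarrow> (nat \<Rightarrow> real \<Rightarrow> real^4)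
      \<Rightarrow> (real \<Rightarrow> real) \<Rightarrow> (real \<Rightarrow> real) \<Rightarrow> (real \<Rightarrow> real) \<Rightarrow> bool" where
  "frenet_curve j I \<beta> F k1 k2 k3 \<longleftrightarrow>
     smooth_on I \<beta> \<and> (\<forall>i\<in>{1..4}. smooth_on I (F i)) \<and>
     smooth_on I k1 \<and> smooth_on I k2 \<and> smooth_on I k3 \<and>
     (\<forall>s\<in>I. \<forall>i\<in>{1..4}. \<forall>i'\<in>{1..4}.
        mink (F i s) (F i' s) = (if i \<noteq> i' then 0 else if i = j then - 1 else 1)) \<and>
     (\<forall>s\<in>I.
        (\<beta> has_vector_derivative F 1 s) (at s) \<and>
        (F 1 has_vector_derivative k1 s *\<^sub>R F 2 s) (at s) \<and>
        (F 2 has_vector_derivative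
           (if j = 2 then k1 s else - k1 s) *\<^sub>R F 1 s + k2 s *\<^sub>R F 3 s) (at s) \<and>
        (F 3 has_vector_derivative
           (if j = 4 then - k2 s else k2 s) *\<^sub>R F 2 s + k3 s *\<^sub>R F 4 s) (at s) \<and>
        (F 4 has_vector_derivative (if j = 2 then - k3 s else k3 s) *\<^sub>R F 3 s) (at s))"

text \<open>The index convention \<open>\<mu>\<^sub>5 = \<mu>\<^sub>2\<close>, \<open>\<mu>\<^sub>6 = \<mu>\<^sub>3\<close>.\<close>

definition wrap :: "nat \<Rightarrow> nat" where
  "wrap i = (if i \<le> 4 then i else i - 3)"

text \<open>For \<open>l = 1\<close> and \<open>l = - 1\<close> the exponents \<open>(1 \<plusminus> l) / 2\<close> are \<open>0\<close> or \<open>1\<close>; they are taken as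
  natural numbers because \<open>sinh w\<close> may be negative.\<close>

definition mu :: "nat \<Rightarrow> int \<Rightarrow> nat \<Rightarrow> real \<Rightarrow> real \<Rightarrow> real" where
  "mu j l i t w =
     (let p = nat ((1 + l) div 2); q = nat ((1 - l) div 2) in
      if i = j then sinh w ^ p * cosh w ^ q * cosh t
      else if i = wrap (j + 1) then sinh w ^ q * cosh w ^ p
      else if i = wrap (j + 2) then sinh w ^ p * cosh w ^ q * sinh t
      else 0)"

text \<open>The parameters are \<open>s = p$1\<close>, \<open>t = p$2\<close>, \<open>w = p$3\<close>.\<close>

definition tube ::
    "nat \<Rightarrow> int \<Rightarrow> real \<Rightarrow> (real \<Rightarrow> real^4) \<Rightarrow> (nat \<Rightarrow> real \<Rightarrow> real^4) \<Rightarrow> real^3 \<Rightarrow> real^4" where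
  "tube j l r \<beta> F p = \<beta> (p$1) + r *\<^sub>R (\<Sum>i=2..4. mu j l i (p$2) (p$3) *\<^sub>R F i (p$1))"

definition tube_normal :: "nat \<Rightarrow> int \<Rightarrow> (nat \<Rightarrow> real \<Rightarrow> real^4) \<Rightarrow> real^3 \<Rightarrow> real^4" where
  "tube_normal j l F p =
     (- ((- 1) ^ fact (4 - j) * of_int l ^ j)) *\<^sub>R
       (\<Sum>i=2..4. mu j l i (p$2) (p$3) *\<^sub>R F i (p$1))"

end

theory Submission
  imports Defs
begin

text \<open>Write \<open>X = \<beta> + r n\<close> and \<open>N = c n\<close> with \<open>c = \<plusminus>1\<close>. Since \<open>N = (c / r) (X - \<beta>)\<close>, the shape
  operator is \<open>a (id - f \<otimes> ds)\<close> with \<open>a = - c / r\<close> and \<open>dX f = F\<^sub>1\<close>. Differentiating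
  \<open>\<langle>n, n\<rangle> = \<lambda>\<close> and \<open>\<langle>n, F\<^sub>1\<rangle> = 0\<close> gives \<open>\<langle>dX \<xi>, F\<^sub>1\<rangle> = \<xi>\<^sub>1 A\<close> with
  \<open>A = 1 \<plusminus> r k\<^sub>1 \<mu>\<^sub>2\<close>, so that \<open>f\<^sub>1 = 1 / A\<close> and the principal curvatures are
  \<open>a, a, a (1 - 1 / A)\<close>. The gradient of \<open>H\<^sub>3\<close> is tangent, so \<open>\<L>\<^sub>2 N = 0\<close> forces
  \<open>H\<^sub>1 H\<^sub>3 = 0\<close>, that is, \<open>A \<in> {1, 1/3}\<close>. Where \<open>k\<^sub>1 \<noteq> 0\<close> this is impossible, as \<open>\<mu>\<^sub>2\<close> would
  take at most two values on an open set of \<open>(t, w)\<close>.\<close>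

section \<open>The Minkowski form and orthogonal complements\<close>

lemma bilinear_mink: "bilinear mink"
  unfolding bilinear_def mink_def
  by (auto intro!: linearI simp: algebra_simps)

lemma bounded_bilinear_mink: "bounded_bilinear mink"
  using bilinear_mink by (simp add: bilinear_conv_bounded_bilinear)

interpretation mink: bounded_bilinear mink
  by (rule bounded_bilinear_mink)

lemma mink_commute: "mink x y = mink y x"
  by (simp add: mink_def algebra_simps)

text \<open>A non-null \<open>v\<close> lies outside its own orthogonal complement, which therefore
  has dimension at most 3. It contains the 3-dimensional image of \<open>L\<close>, so the two
  coincide.\<close>

lemma mink_complement_of_nonnull:
  fixes L :: "real^3 \<Rightarrow> real^4"
  assumes "linear L" "inj L" and L: "\<And>\<xi>. mink (L \<xi>) v = 0"
    and v: "mink v v \<noteq> 0" and x: "mink x v = 0"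
  shows "x \<in> range L"
proof -
  let ?P = "{y. mink y v = 0}"
  have P: "subspace ?P"
    by (auto simp: subspace_def mink.add_left mink.scaleR_left mink.zero_left)
  have "?P \<subset> UNIV"
    using v by auto
  then have "dim ?P < dim (UNIV :: (real^4) set)"
    using P by (intro dim_psubset) (simp add: span_eq_iff[THEN iffD2])
  moreover have "dim (range L) = 3"
    using dim_image_eq[of L UNIV] assms(1,2) by simp
  moreover have "range L \<subseteq> ?P"
    using L by auto
  moreover have "subspace (range L)"
    using assms(1) by (intro linear_subspace_image) auto
  ultimately have "range L = ?P"
    using P by (intro subspace_dim_equal) auto
  then show ?thesis
    using x by blast
qed

section \<open>Symmetric functions of the principal curvatures\<close>

lemma card_1_subsets_3: "{A :: 3 set. A \<subseteq> UNIV \<and> card A = 1} = (\<lambda>i. {i}) ` UNIV"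
  by (auto simp: card_1_singleton_iff)

lemma card_3_subsets_3: "{A :: 3 set. A \<subseteq> UNIV \<and> card A = 3} = {UNIV}"
  using card_subset_eq[of "UNIV :: 3 set"] by auto

lemma prod_UNIV_3: "(\<Prod>i\<in>(UNIV :: 3 set). f i) = f 1 * f 2 * f 3"
  unfolding UNIV_3 by (simp add: ac_simps)

text \<open>The principal curvatures are an arbitrary choice of ordering, but their symmetric
  functions can be read off from the characteristic polynomial.\<close>

lemma principal_curvatures_symmetric:
  assumes char: "\<And>x. det (mat x - matrix (shape_operator X N p)) = (x - a) ^ 2 * (x - b)"
  shows curv_coeff_1: "curv_coeff X N 1 p = - (2 * a + b)"
    and curv_coeff_3: "curv_coeff X N 3 p = - (a ^ 2 * b)"
proof -
  define \<kappa> where "\<kappa> = principal_curvatures X N p"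
  have "\<forall>x. (x - a) ^ 2 * (x - b) = (\<Prod>i\<in>UNIV. x - (if i = (1::3) then b else a))"
    unfolding prod_UNIV_3 power2_eq_square by simp
  then have "\<exists>\<kappa> :: 3 \<Rightarrow> real. \<forall>x. (x - a) ^ 2 * (x - b) = (\<Prod>i\<in>UNIV. x - \<kappa> i)"
    by (rule exI[of _ "\<lambda>i. if i = 1 then b else a"])
  then have "\<forall>x. (x - a) ^ 2 * (x - b) = (\<Prod>i\<in>UNIV. x - \<kappa> i)"
    unfolding \<kappa>_def principal_curvatures_def char
    by (rule someI_ex[where P = "\<lambda>\<kappa>. \<forall>x. (x - a) ^ 2 * (x - b) = (\<Prod>i\<in>UNIV. x - \<kappa> i)"])
  then have eq: "(x - a) ^ 2 * (x - b) = (x - \<kappa> 1) * (x - \<kappa> 2) * (x - \<kappa> 3)" for x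
    by (simp only: prod_UNIV_3)
  have e3: "\<kappa> 1 * \<kappa> 2 * \<kappa> 3 = a ^ 2 * b"
    using eq[of 0] by simp
  have e1: "\<kappa> 1 + \<kappa> 2 + \<kappa> 3 = 2 * a + b"
  proof -
    have expand: "(x - u) * (x - v) * (x - w) =
        x ^ 3 - (u + v + w) * x ^ 2 + (u * v + u * w + v * w) * x - u * v * w" for x u v w :: real
      by algebra
    have "x ^ 3 - (a + a + b) * x ^ 2 + (a * a + a * b + a * b) * x - a ^ 2 * b =
        x ^ 3 - (\<kappa> 1 + \<kappa> 2 + \<kappa> 3) * x ^ 2 +
          (\<kappa> 1 * \<kappa> 2 + \<kappa> 1 * \<kappa> 3 + \<kappa> 2 * \<kappa> 3) * x - a ^ 2 * b" for x
      using eq[of x] unfolding power2_eq_square expand e3[symmetric, unfolded power2_eq_square] .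
    \<comment> \<open>The cubic and constant terms agree. The differences of the two remaining
      coefficients are then equal (at 1) and opposite (at -1), hence zero.\<close>
    from this[of 1] this[of "- 1"] show ?thesis
      by simp
  qed
  show "curv_coeff X N 1 p = - (2 * a + b)"
    using e1 unfolding curv_coeff_def card_1_subsets_3 \<kappa>_def
    by (subst sum.reindex) (auto simp: sum_3)
  show "curv_coeff X N 3 p = - (a ^ 2 * b)"
    using e3 unfolding curv_coeff_def card_3_subsets_3 \<kappa>_def
    by (simp add: prod_UNIV_3)
qed

section \<open>Geometry of a tube around a unit-speed curve\<close>

text \<open>Keeps only a unit tangent field \<open>T\<close> and a field \<open>n\<close> orthogonal
  to it with constant nonzero square, so that all \<open>j\<close> and both signs of
  \<open>l\<close> are treated at once.\<close>

locale canal_hypersurface =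
  fixes X n :: "real^3 \<Rightarrow> real^4" and \<beta> T T' :: "real \<Rightarrow> real^4"
    and r c \<epsilon> :: real and U :: "(real^3) set"
  assumes open_U: "open U" and r_nz: "r \<noteq> 0" and c_nz: "c \<noteq> 0" and eps_nz: "\<epsilon> \<noteq> 0"
    and immersion: "immersion_on U X"
    and X_eq: "\<And>p. X p = \<beta> (p$1) + r *\<^sub>R n p"
    and deriv_curve: "\<And>p. p \<in> U \<Longrightarrow> (\<beta> has_vector_derivative T (p$1)) (at (p$1))"
    and deriv_tangent: "\<And>p. p \<in> U \<Longrightarrow> (T has_vector_derivative T' (p$1)) (at (p$1))"
    and mink_n_n: "\<And>p. p \<in> U \<Longrightarrow> mink (n p) (n p) = \<epsilon>"
    and mink_n_T: "\<And>p. p \<in> U \<Longrightarrow> mink (n p) (T (p$1)) = 0"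
    and mink_T_T: "\<And>p. p \<in> U \<Longrightarrow> mink (T (p$1)) (T (p$1)) = 1"
begin

abbreviation N :: "real^3 \<Rightarrow> real^4" where "N p \<equiv> c *\<^sub>R n p"

abbreviation dX :: "real^3 \<Rightarrow> real^3 \<Rightarrow> real^4" where "dX p \<equiv> frechet_derivative X (at p)"

definition A :: "real^3 \<Rightarrow> real" where "A p = 1 - r * mink (n p) (T' (p$1))"

text \<open>The double principal curvature: the shape operator multiplies every \<open>\<xi>\<close>
  with \<open>\<xi>$1 = 0\<close> by it.\<close>

definition umbilic :: real where "umbilic = - c / r"

lemma umbilic_nz: "umbilic \<noteq> 0"
  using r_nz c_nz by (simp add: umbilic_def)

lemma has_derivative_X: "p \<in> U \<Longrightarrow> (X has_derivative dX p) (at p)"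
  using immersion by (simp add: immersion_on_def frechet_derivative_works)

lemma inj_dX: "p \<in> U \<Longrightarrow> inj (dX p)"
  using immersion by (simp add: immersion_on_def)

lemma linear_dX: "p \<in> U \<Longrightarrow> linear (dX p)"
  using has_derivative_X has_derivative_linear by blast

lemma has_derivative_along_curve:
  assumes "(f has_vector_derivative f') (at (p$1))"
  shows "((\<lambda>q :: real^3. f (q$1)) has_derivative (\<lambda>\<xi>. \<xi>$1 *\<^sub>R f')) (at p)"
proof -
  have "((\<lambda>q :: real^3. q$1) has_derivative (\<lambda>\<xi>. \<xi>$1)) (at p)"
    by (rule bounded_linear_imp_has_derivative) (rule bounded_linear_vec_nth)
  from has_derivative_compose[OF this assms[unfolded has_vector_derivative_def]]
  show ?thesis .
qed

text \<open>\<open>n\<close> inherits its differentiability from \<open>X\<close> and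
  \<open>\<beta>\<close>, which avoids differentiating the frame and the functions
  \<open>mu\<close>.\<close>

lemma has_derivative_n:
  assumes "p \<in> U"
  shows "(n has_derivative (\<lambda>\<xi>. (1 / r) *\<^sub>R (dX p \<xi> - \<xi>$1 *\<^sub>R T (p$1)))) (at p)"
proof -
  have "n = (\<lambda>q. (1 / r) *\<^sub>R (X q - \<beta> (q$1)))"
    using r_nz by (auto simp: X_eq)
  then show ?thesis
    using has_derivative_scaleR_right[OF has_derivative_diff[OF has_derivative_X[OF assms]
          has_derivative_along_curve[OF deriv_curve[OF assms]]], of "1 / r"]
    by simp
qed

lemma has_derivative_const_on_U:
  fixes f :: "real^3 \<Rightarrow> 'b::real_normed_vector"
  assumes "p \<in> U" "\<And>q. q \<in> U \<Longrightarrow> f q = k"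
  shows "(f has_derivative (\<lambda>\<xi>. 0)) (at p)"
  by (rule has_derivative_transform_within_open[OF has_derivative_const open_U])
    (use assms in auto)

lemma mink_dX_n:
  assumes "p \<in> U"
  shows "mink (dX p \<xi>) (n p) = 0"
proof -
  note dn = has_derivative_n[OF assms]
  note d = has_derivative_unique[OF mink.FDERIV[OF dn dn]
      has_derivative_const_on_U[OF assms mink_n_n]]
  from fun_cong[OF d, of \<xi>] show ?thesis
    using mink_n_T[OF assms] r_nz
    by (simp add: mink.scaleR_left mink.scaleR_right mink.diff_left mink.diff_right mink_commute)
qed

lemma mink_dX_T:
  assumes "p \<in> U"
  shows "mink (dX p \<xi>) (T (p$1)) = \<xi>$1 * A p"
proof -
  note d = has_derivative_unique[OF mink.FDERIV[OF has_derivative_n[OF assms]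
        has_derivative_along_curve[OF deriv_tangent[OF assms]]]
      has_derivative_const_on_U[OF assms mink_n_T]]
  from fun_cong[OF d, of \<xi>] show ?thesis
    using mink_T_T[OF assms] r_nz
    by (simp add: A_def mink.scaleR_left mink.scaleR_right mink.diff_left mink.diff_right
        field_simps)
qed

text \<open>On \<open>U\<close> such a vector exists because \<open>T\<close> is orthogonal to the
  non-null normal \<open>n\<close>, hence tangent.\<close>

definition T_coord :: "real^3 \<Rightarrow> real^3" where "T_coord p = (SOME f. dX p f = T (p$1))"

lemma dX_T_coord:
  assumes "p \<in> U"
  shows "dX p (T_coord p) = T (p$1)"
proof -
  have "T (p$1) \<in> range (dX p)"
    using mink_complement_of_nonnull[OF linear_dX inj_dX mink_dX_n]
      assms mink_n_n mink_n_T eps_nz by (simp add: mink_commute)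
  then have "\<exists>f. dX p f = T (p$1)"
    by force
  then show ?thesis
    unfolding T_coord_def by (rule someI_ex)
qed

text \<open>This is \<open>mink_dX_T\<close> at \<open>T_coord p\<close>, as \<open>T\<close> is a
  unit vector. In particular \<open>A\<close> has no zero on \<open>U\<close>.\<close>

lemma T_coord_1_A: "p \<in> U \<Longrightarrow> T_coord p $ 1 * A p = 1"
  using mink_dX_T[of p "T_coord p"] dX_T_coord mink_T_T by simp

section \<open>Shape operator and mean curvatures\<close>

lemma shape_operator_eq:
  assumes "p \<in> U"
  shows "shape_operator X N p \<xi> = umbilic *\<^sub>R (\<xi> - \<xi>$1 *\<^sub>R T_coord p)"
proof -
  have dN: "frechet_derivative N (at p) = (\<lambda>\<xi>. (c / r) *\<^sub>R (dX p \<xi> - \<xi>$1 *\<^sub>R T (p$1)))"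
    using has_derivative_scaleR_right[OF has_derivative_n[OF assms], of c]
    by (intro frechet_derivative_at[symmetric]) simp
  have *: "dX p (umbilic *\<^sub>R (\<xi> - \<xi>$1 *\<^sub>R T_coord p)) = - frechet_derivative N (at p) \<xi>"
    using linear_dX[OF assms] dX_T_coord[OF assms]
    by (simp add: dN umbilic_def linear_cmul linear_diff linear_neg)
  show ?thesis
    unfolding shape_operator_def
    by (rule the_equality, rule *) (rule injD[OF inj_dX[OF assms]], simp only: *)
qed

text \<open>The shape operator differs from a multiple of the identity only in the first column, so
  the matrix is triangular.\<close>

lemma char_poly_shape_operator:
  assumes "p \<in> U"
  shows "det (mat x - matrix (shape_operator X N p)) =
    (x - umbilic) ^ 2 * (x - umbilic * (1 - T_coord p $ 1))"
proof -
  have "(mat x - matrix (shape_operator X N p)) $ i $ k =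
      (if i = k then x - umbilic else 0) + (if k = 1 then umbilic * T_coord p $ i else 0)" for i k
    by (simp add: mat_def matrix_def shape_operator_eq[OF assms] axis_def algebra_simps)
  then have "det (mat x - matrix (shape_operator X N p)) =
      (x - umbilic + umbilic * T_coord p $ 1) * (x - umbilic) * (x - umbilic)"
    by (simp add: det_3)
  also have "\<dots> = (x - umbilic) ^ 2 * (x - umbilic * (1 - T_coord p $ 1))"
    by algebra
  finally show ?thesis .
qed

lemma mink_N_N: "p \<in> U \<Longrightarrow> mink (N p) (N p) = c ^ 2 * \<epsilon>"
  by (simp only: mink.scaleR_left mink.scaleR_right mink_n_n real_scaleR_def power2_eq_square
      mult.assoc)

lemma mean_curv_1:
  assumes "p \<in> U"
  shows "mean_curv X N 1 p = c ^ 2 * \<epsilon> * umbilic * (3 - T_coord p $ 1) / 3"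
  unfolding mean_curv_def mink_N_N[OF assms] curv_coeff_1[OF char_poly_shape_operator[OF assms]]
  by (simp add: algebra_simps)

lemma mean_curv_3:
  assumes "p \<in> U"
  shows "mean_curv X N 3 p = (c ^ 2 * \<epsilon>) ^ 3 * umbilic ^ 3 * (1 - T_coord p $ 1)"
  unfolding mean_curv_def mink_N_N[OF assms] curv_coeff_3[OF char_poly_shape_operator[OF assms]]
  by (simp add: power2_eq_square power3_eq_cube)

section \<open>The harmonicity condition in terms of \<open>A\<close>\<close>

lemma L2_gauss_imp:
  assumes "p \<in> U" and "L2_gauss X N p = 0"
  shows "A p = 1 \<or> A p = 1 / 3"
proof -
  let ?G = "surface_grad X (mean_curv X N 3) p"
  let ?H = "3 * mean_curv X N 1 p * mean_curv X N 3 p"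
  have "?G + ?H *\<^sub>R N p = 0"
    using assms c_nz eps_nz mink_N_N[OF assms(1)] by (simp add: L2_gauss_def Let_def)
  then have "mink (?G + ?H *\<^sub>R N p) (n p) = 0"
    by (simp add: mink.zero_left)
  \<comment> \<open>The gradient is by definition a value of \<open>dX p\<close>, whatever the
    inverse matrix is.\<close>
  moreover have "mink ?G (n p) = 0"
    unfolding surface_grad_def by (rule mink_dX_n[OF assms(1)])
  ultimately have "mean_curv X N 1 p = 0 \<or> mean_curv X N 3 p = 0"
    using mink_n_n[OF assms(1)] c_nz eps_nz
    by (auto simp: mink.add_left mink.scaleR_left)
  \<comment> \<open>The first mean curvature carries the factor \<open>3 - T_coord p $ 1\<close>,
    the third \<open>1 - T_coord p $ 1\<close>.\<close>
  then have "T_coord p $ 1 = 3 \<or> T_coord p $ 1 = 1"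
    unfolding mean_curv_1[OF assms(1)] mean_curv_3[OF assms(1)]
    using c_nz eps_nz umbilic_nz by simp
  then show ?thesis
    using T_coord_1_A[OF assms(1)] by auto
qed

text \<open>\<open>A = 1\<close> makes the third mean curvature vanish on all of the open set
  \<open>U\<close>, so its gradient vanishes too.\<close>

lemma L2_gauss_eq_0:
  assumes "\<And>q. q \<in> U \<Longrightarrow> A q = 1" and "p \<in> U"
  shows "L2_gauss X N p = 0"
proof -
  have H3: "mean_curv X N 3 q = 0" if "q \<in> U" for q
    using T_coord_1_A[OF that] assms(1)[OF that] mean_curv_3[OF that] by simp
  have "frechet_derivative (mean_curv X N 3) (at p) = (\<lambda>\<xi>. 0)"
    using has_derivative_const_on_U[OF assms(2) H3] by (rule frechet_derivative_at[symmetric])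
  then have "surface_grad X (mean_curv X N 3) p = 0"
    using linear_0[OF linear_dX[OF assms(2)]]
    by (simp add: surface_grad_def matrix_vector_mult_def zero_vec_def)
  then show ?thesis
    by (simp add: L2_gauss_def Let_def H3[OF assms(2)])
qed

end

section \<open>The Frenet frame and the functions \<open>mu\<close>\<close>

lemma sum_2_4: "(\<Sum>i=2..4. g i) = g 2 + (g 3 + g 4)" for g :: "nat \<Rightarrow> 'a::comm_monoid_add"
  by (simp add: eval_nat_numeral add.assoc)

lemma mink_sum_frame:
  assumes frame: "\<forall>i\<in>{1..4::nat}. \<forall>i'\<in>{1..4}.
        mink (F i) (F i') = (if i \<noteq> i' then 0 else if i = j then - 1 else 1)"
  shows "mink (\<Sum>i=2..4. m i *\<^sub>R F i) (F 1) = 0"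
    and "mink (\<Sum>i=2..4. m i *\<^sub>R F i) (F 2) = (if j = 2 then - m 2 else m 2)"
    and "mink (\<Sum>i=2..4. m i *\<^sub>R F i) (\<Sum>i=2..4. m i *\<^sub>R F i) =
      (\<Sum>i=2..4. (if i = j then - 1 else 1) * (m i)\<^sup>2)"
proof -
  show "mink (\<Sum>i=2..4. m i *\<^sub>R F i) (F 1) = 0"
    and "mink (\<Sum>i=2..4. m i *\<^sub>R F i) (F 2) = (if j = 2 then - m 2 else m 2)"
    and "mink (\<Sum>i=2..4. m i *\<^sub>R F i) (\<Sum>i=2..4. m i *\<^sub>R F i) =
      (\<Sum>i=2..4. (if i = j then - 1 else 1) * (m i)\<^sup>2)"
    using frame
    by (auto simp: sum_2_4 mink.add_left mink.add_right mink.scaleR_left mink.scaleR_right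
        power2_eq_square)
qed

text \<open>Applies the hyperbolic identity in \<open>t\<close> and in \<open>w\<close>; this is why
  \<open>n\<close> has constant square.\<close>

lemma sum_mu_squares:
  assumes "j \<in> {2, 3, 4}" and "l \<in> {1, - 1}"
  shows "(\<Sum>i=2..4. (if i = j then - 1 else 1) * (mu j l i t w)\<^sup>2) = real_of_int l"
proof -
  have "(cosh w)\<^sup>2 = (sinh w)\<^sup>2 + 1" "(cosh t)\<^sup>2 = (sinh t)\<^sup>2 + 1"
    by (simp_all add: cosh_square_eq)
  then show ?thesis
    using assms
    by (auto simp: sum_2_4 mu_def wrap_def power_mult_distrib algebra_simps)
qed

lemma cosh_eq_same_sign:
  fixes x y :: real
  assumes "cosh x = cosh y" and "x * y \<ge> 0"
  shows "x = y"
proof -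
  have "\<bar>x\<bar> = \<bar>y\<bar>"
    using assms(1) cosh_real_nonneg_less_iff[of "\<bar>x\<bar>" "\<bar>y\<bar>"]
      cosh_real_nonneg_less_iff[of "\<bar>y\<bar>" "\<bar>x\<bar>"] by force
  then show ?thesis
    using assms(2) by (auto simp: abs_if mult_le_0_iff zero_le_mult_iff split: if_splits)
qed

lemma mu_2_nonzero:
  assumes "j \<in> {2, 3, 4}" and "l \<in> {1, - 1}" and "t \<noteq> 0" and "w \<noteq> 0"
  shows "mu j l 2 t w \<noteq> 0"
  using assms by (auto simp: mu_def wrap_def)

text \<open>\<open>mu j l 2\<close> is \<open>sinh w\<close> or \<open>cosh w\<close> times
  \<open>cosh t\<close>, \<open>sinh t\<close> or 1. The condition on \<open>t\<close> keeps
  \<open>sinh t\<close> away from 0, and the sign condition makes up for the evenness of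
  \<open>cosh\<close>.\<close>

lemma mu_2_inj:
  assumes "j \<in> {2, 3, 4}" and "l \<in> {1, - 1}" and "t \<noteq> 0"
    and "mu j l 2 t w = mu j l 2 t w'" and "w * w' \<ge> 0"
  shows "w = w'"
proof -
  have "sinh w = sinh w' \<or> cosh w = cosh w'"
    using assms(1-4) by (auto simp: mu_def wrap_def)
  then show ?thesis
  proof
    assume "cosh w = cosh w'"
    then show ?thesis
      using assms(5) by (rule cosh_eq_same_sign)
  qed simp
qed

text \<open>Supplies two points over the same curve parameter to which \<open>mu_2_nonzero\<close>
  and \<open>mu_2_inj\<close> apply.\<close>

lemma open_vec3_vary:
  fixes U :: "(real^3) set"
  assumes "open U" and "p \<in> U"
  obtains t w w' where "t \<noteq> 0" "w \<noteq> 0" "w' \<noteq> 0" "w \<noteq> w'" "w * w' \<ge> 0"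
    "vector [p$1, t, w] \<in> U" "vector [p$1, t, w'] \<in> U"
proof -
  define g :: "real \<Rightarrow> real \<Rightarrow> real^3" where
    "g x y = p + x *\<^sub>R axis 2 1 + y *\<^sub>R axis 3 1" for x y
  have g: "g x y = vector [p$1, p$2 + x, p$3 + y]" for x y
    unfolding g_def vec_eq_iff forall_3 by (simp add: axis_def)
  obtain e where "e > 0" and e: "ball p e \<subseteq> U"
    using assms open_contains_ball by blast
  have gU: "g x y \<in> U" if "\<bar>x\<bar> + \<bar>y\<bar> < e" for x y
  proof -
    have "dist p (g x y) = norm (x *\<^sub>R axis 2 1 + y *\<^sub>R axis 3 1 :: real^3)"
      unfolding dist_commute[of p] by (simp add: g_def dist_norm add.assoc)
    also have "\<dots> \<le> \<bar>x\<bar> + \<bar>y\<bar>"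
      by (rule norm_triangle_le) (simp add: norm_axis_1)
    finally have "dist p (g x y) < e"
      using that by simp
    then show ?thesis
      using e by auto
  qed
  \<comment> \<open>Both shifts point away from 0, so the new coordinates are nonzero and the two
    values of \<open>w\<close> have the same sign. The total shift is at most
    \<open>3 * e / 4\<close>.\<close>
  define x where "x = (if p$2 \<ge> 0 then e / 4 else - e / 4)"
  define y where "y = (if p$3 \<ge> 0 then e / 4 else - e / 4)"
  show thesis
  proof (rule that)
    show "vector [p$1, p$2 + x, p$3 + y] \<in> U" "vector [p$1, p$2 + x, p$3 + 2 * y] \<in> U"
      using gU[of x y] gU[of x "2 * y"] \<open>e > 0\<close> by (auto simp: g x_def y_def)
    show "(p$3 + y) * (p$3 + 2 * y) \<ge> 0"
      using \<open>e > 0\<close> by (auto simp: y_def zero_le_mult_iff)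
  qed (use \<open>e > 0\<close> in \<open>auto simp: x_def y_def\<close>)
qed

section \<open>Application to the tubular hypersurface\<close>

theorem theorem16:
  fixes j :: nat and l :: int and r :: real
    and I :: "real set" and \<beta> :: "real \<Rightarrow> real^4" and F :: "nat \<Rightarrow> real \<Rightarrow> real^4"
    and k1 k2 k3 :: "real \<Rightarrow> real" and U :: "(real^3) set"
  assumes "j \<in> {2, 3, 4}" and "l \<in> {1, - 1}" and "r > 0"
    and "open I" and "is_interval I"
    and "frenet_curve j I \<beta> F k1 k2 k3"
    and "open U" and "connected U" and "(\<lambda>p. p$1) ` U = I"
    and "immersion_on U (tube j l r \<beta> F)"
  shows "(\<forall>p\<in>U. L2_gauss (tube j l r \<beta> F) (tube_normal j l F) p = 0) \<longleftrightarrow> (\<forall>s\<in>I. k1 s = 0)"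
proof -
  define n where "n p = (\<Sum>i=2..4. mu j l i (p$2) (p$3) *\<^sub>R F i (p$1))" for p :: "real^3"
  define c :: real where "c = - ((- 1) ^ fact (4 - j) * of_int l ^ j)"
  \<comment> \<open>This sign is \<open>- mink (F 2 s) (F 2 s)\<close> for \<open>s\<close> in
    \<open>I\<close>, which is also \<open>(- 1) ^ fact (4 - j)\<close>.\<close>
  define \<sigma> :: real where "\<sigma> = (if j = 2 then 1 else - 1)"
  have UI: "p$1 \<in> I" if "p \<in> U" for p
    using assms(9) that by blast
  have frame: "\<forall>i\<in>{1..4}. \<forall>i'\<in>{1..4}.
      mink (F i s) (F i' s) = (if i \<noteq> i' then 0 else if i = j then - 1 else 1)" if "s \<in> I" for s
    using assms(6) that by (simp add: frenet_curve_def)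
  interpret canal_hypersurface "tube j l r \<beta> F" n \<beta> "F 1" "\<lambda>s. k1 s *\<^sub>R F 2 s" r c
    "real_of_int l" U
  proof
    show "c \<noteq> 0" "real_of_int l \<noteq> 0"
      using assms(2) by (auto simp: c_def)
    show "tube j l r \<beta> F p = \<beta> (p$1) + r *\<^sub>R n p" for p
      by (simp add: tube_def n_def)
  next
    fix p assume "p \<in> U"
    note s = UI[OF this]
    show "(\<beta> has_vector_derivative F 1 (p$1)) (at (p$1))"
      "(F 1 has_vector_derivative k1 (p$1) *\<^sub>R F 2 (p$1)) (at (p$1))"
      using assms(6) s by (auto simp: frenet_curve_def)
    show "mink (F 1 (p$1)) (F 1 (p$1)) = 1"
      using frame[OF s] assms(1) by auto
    show "mink (n p) (n p) = real_of_int l"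
      unfolding n_def mink_sum_frame(3)[OF frame[OF s]] by (rule sum_mu_squares[OF assms(1,2)])
    show "mink (n p) (F 1 (p$1)) = 0"
      unfolding n_def by (rule mink_sum_frame(1)[OF frame[OF s]])
  qed (use assms in auto)
  have N: "tube_normal j l F = N"
    by (auto simp: tube_normal_def n_def c_def)
  have A: "A p = 1 + \<sigma> * r * k1 (p$1) * mu j l 2 (p$2) (p$3)" if "p \<in> U" for p
    using mink_sum_frame(2)[OF frame[OF UI[OF that]]]
    by (simp add: A_def mink.scaleR_right n_def \<sigma>_def)
  show ?thesis
    unfolding N
  proof
    assume L2: "\<forall>p\<in>U. L2_gauss (tube j l r \<beta> F) N p = 0"
    show "\<forall>s\<in>I. k1 s = 0"
    proof (rule ballI, rule ccontr)
      fix s assume "s \<in> I" and k1: "k1 s \<noteq> 0"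
      then obtain p where p: "p \<in> U" "p$1 = s"
        using assms(9) by blast
      obtain t w w' where tw: "t \<noteq> 0" "w \<noteq> 0" "w' \<noteq> 0" "w \<noteq> w'" "w * w' \<ge> 0"
        "vector [s, t, w] \<in> U" "vector [s, t, w'] \<in> U"
        using open_vec3_vary[OF assms(7) p(1)] p(2) by metis
      \<comment> \<open>The value \<open>A = 1\<close> is excluded because \<open>k1 s\<close> and
        \<open>mu j l 2 t v\<close> are nonzero, which leaves \<open>A = 1 / 3\<close>.\<close>
      have val: "\<sigma> * r * k1 s * mu j l 2 t v = - 2 / 3"
        if "v \<noteq> 0" and v: "vector [s, t, v] \<in> U" for v
        using L2_gauss_imp[OF v] L2 v A[OF v] mu_2_nonzero[OF assms(1,2) tw(1) that(1)] k1 assms(3)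
        by (auto simp: vector_3 \<sigma>_def split: if_splits)
      have "\<sigma> * r * k1 s * mu j l 2 t w = \<sigma> * r * k1 s * mu j l 2 t w'"
        using val tw by metis
      then have "mu j l 2 t w = mu j l 2 t w'"
        using k1 assms(3) by (auto simp: \<sigma>_def split: if_splits)
      then show False
        using mu_2_inj[OF assms(1,2) tw(1)] tw by blast
    qed
  next
    assume "\<forall>s\<in>I. k1 s = 0"
    then show "\<forall>p\<in>U. L2_gauss (tube j l r \<beta> F) N p = 0"
      using A UI by (auto intro!: L2_gauss_eq_0)
  qed
qed

end
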